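(* For every positive integer $n$, there exists a finite perfect left brace $B$ such that $\mathrm{Soc}(B/\mathrm{Soc}_n(B))\neq\{0\}$.
   Context: A skew left brace is a triple $(A,+,\circ)$ where $(A,+)$ and $(A,\circ)$ are (not necessarily abelian) groups such that $a\circ(b+c)=a\circ b-a+a\circ c$ for all $a,b,c\in A$. A left brace is a skew left brace whose additive group $(A,+)$ is abelian. For $a,b\in A$ put $a*b=-a+a\circ b-b$; $A^2=A*A$ is the subgroup of $(A,+)$ generated by all $a*b$ with $a,b\in A$, and $A$ is perfect if $A^2=A$. An ideal of $A$ is a subset that is a normal subgroup of both $(A,+)$ and $(A,\circ)$ and is stable under all maps $\lambda_a\colon b\mapsto -a+a\circ b$, $a\in A$; quotients by ideals are skew left braces. The socle $\mathrm{Soc}(A)=\{x\in A: x\circ a=x+a \text{ and } x+a=a+x \text{ for all } a\in A\}$ is an ideal of $A$. Define $\mathrm{Soc}_0(A)=0$ and, for $n\ge 1$, let $\mathrm{Soc}_n(A)$ be the ideal of $A$ containing $\mathrm{Soc}_{n-1}(A)$ such that $\mathrm{Soc}_n(A)/\mathrm{Soc}_{n-1}(A)=\mathrm{Soc}(A/\mathrm{Soc}_{n-1}(A))$. *)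

theory Defs
  imports "HOL-Algebra.Generated_Groups" "HOL-Algebra.AbelCoset"
begin

text \<open>
  A skew left brace \<open>(A, +, \<circ>)\<close> is carried by the record type \<open>ring\<close>, which is used only as a
  carrier with two operations: \<open>\<oplus>\<close>, \<open>\<zero>\<close>, \<open>\<ominus>\<close> belong to the (possibly nonabelian) group
  \<open>(A, +)\<close> = \<open>add_monoid A\<close>, while \<open>\<otimes>\<close>, \<open>\<one>\<close>, \<open>inv\<close> belong to the group \<open>(A, \<circ>)\<close>.
  That \<open>\<zero> = \<one>\<close> is a consequence of the axioms, see \<open>zero_eq_one\<close>.
\<close>

locale skew_left_brace = group A for A (structure) +
  assumes add_group: "group (add_monoid A)"
    and brace_distrib:
      "\<lbrakk> a \<in> carrier A; b \<in> carrier A; c \<in> carrier A \<rbrakk>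
        \<Longrightarrow> a \<otimes> (b \<oplus> c) = a \<otimes> b \<ominus> a \<oplus> a \<otimes> c"

locale left_brace = skew_left_brace A for A (structure) +
  assumes add_comm_group: "comm_group (add_monoid A)"

definition brace_star :: "('a, 'm) ring_scheme \<Rightarrow> 'a \<Rightarrow> 'a \<Rightarrow> 'a"
  where "brace_star A a b = \<ominus>\<^bsub>A\<^esub> a \<oplus>\<^bsub>A\<^esub> a \<otimes>\<^bsub>A\<^esub> b \<ominus>\<^bsub>A\<^esub> b"

definition brace_square :: "('a, 'm) ring_scheme \<Rightarrow> 'a set"
  where "brace_square A =
    generate (add_monoid A) {brace_star A a b | a b. a \<in> carrier A \<and> b \<in> carrier A}"

definition perfect_brace :: "('a, 'm) ring_scheme \<Rightarrow> bool"
  where "perfect_brace A \<longleftrightarrow> brace_square A = carrier A"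

definition brace_lambda :: "('a, 'm) ring_scheme \<Rightarrow> 'a \<Rightarrow> 'a \<Rightarrow> 'a"
  where "brace_lambda A a b = \<ominus>\<^bsub>A\<^esub> a \<oplus>\<^bsub>A\<^esub> a \<otimes>\<^bsub>A\<^esub> b"

definition brace_ideal :: "'a set \<Rightarrow> ('a, 'm) ring_scheme \<Rightarrow> bool"
  where "brace_ideal I A \<longleftrightarrow>
    I \<lhd> add_monoid A \<and> I \<lhd> A \<and> (\<forall>a\<in>carrier A. \<forall>b\<in>I. brace_lambda A a b \<in> I)"

text \<open>
  For an ideal \<open>I\<close> the additive and the multiplicative coset of an element coincide
  (\<open>coset_eq_coset\<close> below), so the elementwise operations on additive cosets are the operations
  of both factor groups \<open>(A, +) / I\<close> and \<open>(A, \<circ>) / I\<close>.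
\<close>

definition brace_quotient :: "('a, 'm) ring_scheme \<Rightarrow> 'a set \<Rightarrow> 'a set ring"
  where "brace_quotient A I =
    \<lparr>carrier = a_rcosets\<^bsub>A\<^esub> I, mult = set_mult A, one = I, zero = I, add = set_add A\<rparr>"

definition brace_socle :: "('a, 'm) ring_scheme \<Rightarrow> 'a set"
  where "brace_socle A = {x \<in> carrier A. \<forall>a\<in>carrier A.
    x \<otimes>\<^bsub>A\<^esub> a = x \<oplus>\<^bsub>A\<^esub> a \<and> x \<oplus>\<^bsub>A\<^esub> a = a \<oplus>\<^bsub>A\<^esub> x}"

text \<open>
  The ideal \<open>Soc\<^sub>n\<^sub>+\<^sub>1(A)\<close> with \<open>Soc\<^sub>n\<^sub>+\<^sub>1(A) / Soc\<^sub>n(A) = Soc(A / Soc\<^sub>n(A))\<close> is the preimage of the socle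
  under the canonical map; theorem \<open>socle_series_Suc_characterization\<close> below shows that this is
  the unique ideal with that property.
\<close>

fun socle_series :: "('a, 'm) ring_scheme \<Rightarrow> nat \<Rightarrow> 'a set"
  where
    "socle_series A 0 = {\<zero>\<^bsub>A\<^esub>}"
  | "socle_series A (Suc n) =
      {x \<in> carrier A. socle_series A n +>\<^bsub>A\<^esub> x \<in> brace_socle (brace_quotient A (socle_series A n))}"


context skew_left_brace
begin

sublocale add: group "add_monoid A"
  rewrites "carrier (add_monoid A) = carrier A"
    and "mult (add_monoid A) = add A"
    and "one (add_monoid A) = zero A"
    and "m_inv (add_monoid A) = a_inv A"
    and "r_coset (add_monoid A) = a_r_coset A"
  using add_group by (auto simp: a_inv_def a_r_coset_def)

lemma zero_eq_one: "\<zero> = \<one>"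
  using brace_distrib[of \<one> \<one> \<zero>]
  by (metis a_minus_def add.one_closed add.r_one add.inv_closed add.r_inv l_one one_closed)

abbreviation lam where "lam \<equiv> brace_lambda A"

lemma lam_closed: "a \<in> carrier A \<Longrightarrow> b \<in> carrier A \<Longrightarrow> lam a b \<in> carrier A"
  by (simp add: brace_lambda_def)

lemma mult_eq: "a \<in> carrier A \<Longrightarrow> b \<in> carrier A \<Longrightarrow> a \<otimes> b = a \<oplus> lam a b"
  by (simp add: brace_lambda_def add.m_assoc[symmetric])

lemma lam_add:
  assumes "a \<in> carrier A" "b \<in> carrier A" "c \<in> carrier A"
  shows "lam a (b \<oplus> c) = lam a b \<oplus> lam a c"
  using assms by (simp add: brace_lambda_def brace_distrib a_minus_def add.m_assoc)

lemma lam_mult: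
  assumes "a \<in> carrier A" "b \<in> carrier A" "c \<in> carrier A"
  shows "lam (a \<otimes> b) c = lam a (lam b c)"
proof -
  have "a \<otimes> b \<oplus> lam (a \<otimes> b) c = a \<otimes> (b \<otimes> c)"
    using assms by (simp add: mult_eq[symmetric] m_assoc)
  also have "\<dots> = a \<oplus> (lam a (b \<oplus> lam b c))"
    using assms by (simp add: mult_eq lam_closed)
  also have "\<dots> = a \<otimes> b \<oplus> lam a (lam b c)"
    using assms by (simp add: lam_add lam_closed mult_eq add.m_assoc)
  finally show ?thesis using assms by (simp add: lam_closed)
qed

lemma lam_one: "a \<in> carrier A \<Longrightarrow> lam \<one> a = a"
  using add.inv_one by (simp add: brace_lambda_def zero_eq_one)

lemma lam_surj:
  assumes "a \<in> carrier A" "b \<in> carrier A"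
  shows "lam a (lam (inv a) b) = b"
  using assms by (simp add: lam_mult[symmetric] lam_one)

lemma ideal_lam:
  "brace_ideal I A \<Longrightarrow> a \<in> carrier A \<Longrightarrow> b \<in> I \<Longrightarrow> lam a b \<in> I"
  by (simp add: brace_ideal_def)

lemma coset_eq_coset:
  assumes I: "brace_ideal I A" and a: "a \<in> carrier A"
  shows "I +> a = I #> a"
proof -
  interpret IP: normal I "add_monoid A" using I by (simp add: brace_ideal_def)
  interpret IM: normal I A using I by (simp add: brace_ideal_def)
  have "I +> a = a <#\<^bsub>add_monoid A\<^esub> I"
    using IP.coset_eq a by (simp add: a_r_coset_def)
  also have "\<dots> = a <# I"
  proof (intro equalityI subsetI)
    fix x assume "x \<in> a <#\<^bsub>add_monoid A\<^esub> I"
    then obtain i where i: "i \<in> I" "x = a \<oplus> i" by (auto simp: l_coset_def)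
    have "x = a \<otimes> lam (inv a) i"
      using a i IM.mem_carrier by (simp add: mult_eq lam_closed lam_surj)
    thus "x \<in> a <# I" using ideal_lam[OF I, of "inv a" i] a i by (auto simp: l_coset_def)
  next
    fix x assume "x \<in> a <# I"
    then obtain i where i: "i \<in> I" "x = a \<otimes> i" by (auto simp: l_coset_def)
    have "x = a \<oplus> lam a i"
      using a i IM.mem_carrier by (simp add: mult_eq)
    thus "x \<in> a <#\<^bsub>add_monoid A\<^esub> I" using ideal_lam[OF I a] i by (auto simp: l_coset_def)
  qed
  also have "\<dots> = I #> a" using IM.coset_eq a by simp
  finally show ?thesis .
qed

lemma quotient_carrier: "carrier (brace_quotient A I) = {I +> a | a. a \<in> carrier A}"
  by (auto simp: brace_quotient_def A_RCOSETS_def')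

lemma
  assumes I: "brace_ideal I A" and a: "a \<in> carrier A" and b: "b \<in> carrier A"
  shows quotient_mult: "(I +> a) \<otimes>\<^bsub>brace_quotient A I\<^esub> (I +> b) = I +> a \<otimes> b"
    and quotient_add: "(I +> a) \<oplus>\<^bsub>brace_quotient A I\<^esub> (I +> b) = I +> (a \<oplus> b)"
proof -
  interpret IP: normal I "add_monoid A" using I by (simp add: brace_ideal_def)
  interpret IM: normal I A using I by (simp add: brace_ideal_def)
  show "(I +> a) \<otimes>\<^bsub>brace_quotient A I\<^esub> (I +> b) = I +> a \<otimes> b"
    using a b by (simp add: brace_quotient_def coset_eq_coset[OF I] IM.rcos_sum)
  show "(I +> a) \<oplus>\<^bsub>brace_quotient A I\<^esub> (I +> b) = I +> (a \<oplus> b)"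
    using a b IP.rcos_sum[of a b] by (simp add: brace_quotient_def set_add_def a_r_coset_def)
qed

lemma coset_eq_iff:
  assumes "brace_ideal I A" "a \<in> carrier A"
  shows "I +> a = I \<longleftrightarrow> a \<in> I"
proof -
  have "subgroup I A" using assms by (simp add: brace_ideal_def normal_def)
  thus ?thesis using assms coset_eq_coset coset_join1 coset_join2 by metis
qed

theorem skew_left_brace_quotient:
  assumes I: "brace_ideal I A"
  shows "skew_left_brace (brace_quotient A I)"
proof -
  let ?Q = "brace_quotient A I"
  interpret IP: normal I "add_monoid A" using I by (simp add: brace_ideal_def)
  interpret IM: normal I A using I by (simp add: brace_ideal_def)
  have "add_monoid ?Q = add_monoid A Mod I"
    by (simp add: FactGroup_def brace_quotient_def A_RCOSETS_def set_add_def)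
  hence gP: "group (add_monoid ?Q)" using IP.factorgroup_is_group by simp
  have carr: "carrier ?Q = carrier (A Mod I)"
    by (auto simp: quotient_carrier FactGroup_def RCOSETS_def coset_eq_coset[OF I, symmetric])
  have gM: "group ?Q"
    using IM.factorgroup_is_group carr
    unfolding group_def group_axioms_def monoid_def Units_def
    by (simp add: FactGroup_def brace_quotient_def)
  have minus: "\<ominus>\<^bsub>?Q\<^esub> (I +> a) = I +> \<ominus> a" if a: "a \<in> carrier A" for a
  proof -
    have "(I +> \<ominus> a) \<oplus>\<^bsub>?Q\<^esub> (I +> a) = \<zero>\<^bsub>?Q\<^esub>"
      using quotient_add[OF I, of "\<ominus> a" a] a coset_eq_iff[OF I, of \<zero>] IP.one_closed
      by (simp add: brace_quotient_def)
    thus ?thesis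
      using group.inv_equality[OF gP, of "I +> \<ominus> a" "I +> a"] a
      by (auto simp: a_inv_def[of ?Q] quotient_carrier)
  qed
  show ?thesis
  proof (intro skew_left_brace.intro skew_left_brace_axioms.intro gM gP)
    fix X Y Z assume "X \<in> carrier ?Q" "Y \<in> carrier ?Q" "Z \<in> carrier ?Q"
    then obtain a b c where "a \<in> carrier A" "X = I +> a" "b \<in> carrier A" "Y = I +> b"
      "c \<in> carrier A" "Z = I +> c" by (auto simp: quotient_carrier)
    thus "X \<otimes>\<^bsub>?Q\<^esub> (Y \<oplus>\<^bsub>?Q\<^esub> Z) = X \<otimes>\<^bsub>?Q\<^esub> Y \<ominus>\<^bsub>?Q\<^esub> X \<oplus>\<^bsub>?Q\<^esub> X \<otimes>\<^bsub>?Q\<^esub> Z"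
      by (simp add: quotient_add[OF I] quotient_mult[OF I] a_minus_def minus brace_distrib)
  qed
qed

lemma ideal_zero: "brace_ideal {\<zero>} A"
proof -
  have "{\<zero>} \<lhd> add_monoid A" using add.one_is_normal by simp
  moreover have "{\<zero>} \<lhd> A" using one_is_normal by (simp add: zero_eq_one)
  moreover have "lam a \<zero> = \<zero>" if "a \<in> carrier A" for a
    using that by (simp add: brace_lambda_def zero_eq_one)
  ultimately show ?thesis by (simp add: brace_ideal_def)
qed

lemma socle_iff:
  "x \<in> brace_socle A \<longleftrightarrow>
    x \<in> carrier A \<and> (\<forall>a\<in>carrier A. lam x a = a \<and> x \<oplus> a = a \<oplus> x)"
  by (auto simp: brace_socle_def mult_eq lam_closed)

theorem ideal_socle: "brace_ideal (brace_socle A) A"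
proof -
  let ?S = "brace_socle A"
  have S: "x \<in> carrier A" if "x \<in> ?S" for x using that by (simp add: socle_iff)
  have mult_add: "x \<otimes> y = x \<oplus> y" if "x \<in> ?S" "y \<in> carrier A" for x y
    using that by (simp add: brace_socle_def)
  have one: "\<one> \<in> ?S"
    by (simp add: socle_iff lam_one) (simp add: zero_eq_one[symmetric])
  have mult: "x \<otimes> y \<in> ?S" if "x \<in> ?S" "y \<in> ?S" for x y
  proof -
    have "x \<oplus> y \<oplus> a = a \<oplus> (x \<oplus> y)" if a: "a \<in> carrier A" for a
    proof -
      have "y \<oplus> a = a \<oplus> y" "x \<oplus> a = a \<oplus> x"
        using \<open>x \<in> ?S\<close> \<open>y \<in> ?S\<close> a by (simp_all add: socle_iff)
      thus ?thesis
        using add.m_assoc[of x y a] add.m_assoc[of x a y] add.m_assoc[of a x y]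
          S[OF \<open>x \<in> ?S\<close>] S[OF \<open>y \<in> ?S\<close>] a by simp
    qed
    moreover have "lam (x \<otimes> y) a = a" if "a \<in> carrier A" for a
      using that \<open>x \<in> ?S\<close> \<open>y \<in> ?S\<close> by (simp add: lam_mult S) (simp add: socle_iff)
    ultimately show ?thesis using mult_add[OF that(1) S[OF that(2)]] S[OF that(1)] S[OF that(2)] by (simp add: socle_iff)
  qed
  have inv_eq: "inv x = \<ominus> x" if "x \<in> ?S" for x
  proof -
    have "x \<otimes> \<ominus> x = \<one>" using that S by (simp add: mult_add zero_eq_one[symmetric])
    hence "inv (\<ominus> x) = x" using that S by (simp add: inv_equality)
    thus ?thesis using that S inv_inv[of "\<ominus> x"] by simp
  qed
  have inv: "inv x \<in> ?S" if "x \<in> ?S" for x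
  proof -
    have "lam (inv x) a = a" if "a \<in> carrier A" for a
      using that \<open>x \<in> ?S\<close> lam_mult[of "inv x" x a] by (simp add: S lam_one) (simp add: socle_iff)
    moreover have "\<ominus> x \<oplus> a = a \<oplus> \<ominus> x" if a: "a \<in> carrier A" for a
    proof -
      have x: "x \<in> carrier A" "x \<oplus> a = a \<oplus> x" using \<open>x \<in> ?S\<close> a by (simp_all add: socle_iff)
      have "\<ominus> x \<oplus> a = \<ominus> x \<oplus> (a \<oplus> x \<oplus> \<ominus> x)" using x(1) a by (simp add: add.m_assoc)
      also have "\<dots> = a \<oplus> \<ominus> x"
        using x(1) a by (simp add: x(2)[symmetric] add.m_assoc[symmetric])
      finally show ?thesis .
    qed
    ultimately show ?thesis using inv_eq[OF that] S[OF that] by (simp add: socle_iff)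
  qed
  have sM: "subgroup ?S A"
    using S one mult inv by (auto intro!: subgroup.intro)
  have zero: "\<zero> \<in> ?S" using one by (simp add: zero_eq_one)
  have sP: "subgroup ?S (add_monoid A)"
    using S zero mult inv
    by (auto intro!: subgroup.intro simp: a_inv_def[symmetric] mult_add[symmetric] inv_eq[symmetric])
  have nP: "?S \<lhd> add_monoid A"
    using sP add.normalI[of ?S] by (auto simp: a_r_coset_def r_coset_def l_coset_def socle_iff)
  have conj: "a \<otimes> x \<otimes> inv a = lam a x \<and> lam a x \<in> ?S" if a: "a \<in> carrier A" and x: "x \<in> ?S" for a x
  proof -
    let ?y = "lam a x"
    have y: "?y \<in> carrier A" using a x S by (simp add: lam_closed)
    have cent: "?y \<oplus> b = b \<oplus> ?y" if b: "b \<in> carrier A" for b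
    proof -
      let ?b = "lam (inv a) b"
      have b': "?b \<in> carrier A" using a b by (simp add: lam_closed)
      have "lam a (x \<oplus> ?b) = lam a (?b \<oplus> x)" using x b' by (simp add: socle_iff)
      thus ?thesis using a b b' x S by (simp add: lam_add lam_surj)
    qed
    have "a \<otimes> x \<otimes> inv a = a \<otimes> (x \<oplus> inv a)" using a x S by (simp add: m_assoc mult_add)
    also have "\<dots> = a \<otimes> x \<ominus> a \<oplus> a \<otimes> inv a" using a x S by (simp add: brace_distrib)
    also have "\<dots> = a \<otimes> x \<ominus> a" using a x S
      by (simp add: a_minus_def zero_eq_one[symmetric])
    also have "\<dots> = ?y \<oplus> a \<ominus> a" using a x S by (simp add: mult_eq cent)
    also have "\<dots> = ?y" using a y by (simp add: a_minus_def add.m_assoc)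
    finally have eq: "a \<otimes> x \<otimes> inv a = ?y" .
    have "lam ?y b = b" if b: "b \<in> carrier A" for b
    proof -
      have "lam ?y b = lam a (lam x (lam (inv a) b))"
        using a x S b by (simp add: eq[symmetric] lam_mult lam_closed)
      also have "\<dots> = b" using a x b by (simp add: socle_iff lam_closed lam_surj)
      finally show ?thesis .
    qed
    with eq y cent show ?thesis by (simp add: socle_iff)
  qed
  have "?S \<lhd> A" using sM conj by (auto simp: normal_inv_iff)
  with nP conj show ?thesis by (simp add: brace_ideal_def)
qed

theorem ideal_preimage:
  assumes I: "brace_ideal I A" and J: "brace_ideal J (brace_quotient A I)"
  shows "brace_ideal {x \<in> carrier A. I +> x \<in> J} A"
proof -
  let ?Q = "brace_quotient A I" and ?P = "{x \<in> carrier A. I +> x \<in> J}"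
  interpret Q: skew_left_brace ?Q by (rule skew_left_brace_quotient[OF I])
  interpret JP: normal J "add_monoid ?Q" using J by (simp add: brace_ideal_def)
  interpret JM: normal J ?Q using J by (simp add: brace_ideal_def)
  have hM: "group_hom A ?Q (\<lambda>x. I +> x)"
    by unfold_locales (auto simp: hom_def quotient_carrier quotient_mult[OF I])
  have hP: "group_hom (add_monoid A) (add_monoid ?Q) (\<lambda>x. I +> x)"
    unfolding group_hom_def group_hom_axioms_def
    using add_group Q.add_group by (auto simp: hom_def quotient_carrier quotient_add[OF I])
  have minus: "I +> \<ominus> a = \<ominus>\<^bsub>?Q\<^esub> (I +> a)" if "a \<in> carrier A" for a
    using group_hom.hom_inv[OF hP, of a] that by (simp add: a_inv_def)
  have lam: "I +> lam a b = brace_lambda ?Q (I +> a) (I +> b)"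
    if "a \<in> carrier A" "b \<in> carrier A" for a b
    using that by (simp add: brace_lambda_def minus[symmetric] quotient_add[OF I] quotient_mult[OF I])
  have inc: "I +> a \<in> carrier ?Q" if "a \<in> carrier A" for a
    using that by (auto simp: quotient_carrier)
  have one: "I +> \<one> = \<one>\<^bsub>?Q\<^esub>" using group_hom.hom_one[OF hM] .
  have zero: "I +> \<zero> = \<zero>\<^bsub>?Q\<^esub>" using group_hom.hom_one[OF hP] by simp
  have invM: "I +> inv a = inv\<^bsub>?Q\<^esub> (I +> a)" if "a \<in> carrier A" for a
    using group_hom.hom_inv[OF hM, of a] that by simp
  have "?P \<lhd> A"
    unfolding normal_inv_iff
    using JM.one_closed JM.m_closed JM.m_inv_closed JM.inv_op_closed2
    by (auto intro!: subgroup.intro simp: one invM inc quotient_mult[OF I, symmetric])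
  moreover have "?P \<lhd> add_monoid A"
    unfolding group.normal_inv_iff[OF add_group]
    using JP.one_closed JP.m_closed JP.m_inv_closed JP.inv_op_closed2
    by (auto intro!: subgroup.intro
        simp: zero minus a_inv_def[of A, symmetric] a_inv_def[of ?Q] inc quotient_add[OF I, symmetric])
  moreover have "lam a b \<in> ?P" if "a \<in> carrier A" "b \<in> ?P" for a b
    using that J by (auto simp: lam lam_closed inc brace_ideal_def)
  ultimately show ?thesis by (auto simp: brace_ideal_def)
qed

theorem ideal_socle_series: "brace_ideal (socle_series A n) A"
proof (induction n)
  case 0
  show ?case by (simp add: ideal_zero)
next
  case (Suc n)
  interpret Q: skew_left_brace "brace_quotient A (socle_series A n)"
    by (rule skew_left_brace_quotient[OF Suc])
  show ?case using ideal_preimage[OF Suc Q.ideal_socle] by simp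
qed

theorem socle_series_Suc_characterization:
  "I = socle_series A (Suc n) \<longleftrightarrow>
    brace_ideal I A \<and> socle_series A n \<subseteq> I \<and>
    (\<lambda>x. socle_series A n +> x) ` I = brace_socle (brace_quotient A (socle_series A n))"
proof -
  let ?J = "socle_series A n"
  let ?S = "brace_socle (brace_quotient A ?J)"
  note J = ideal_socle_series[of n]
  interpret Q: skew_left_brace "brace_quotient A ?J" by (rule skew_left_brace_quotient[OF J])
  have sJ: "subgroup ?J A" using J by (simp add: brace_ideal_def normal_def)
  have "?J \<in> ?S"
    using subgroup.one_closed[of ?S "brace_quotient A ?J"] Q.ideal_socle
    by (simp add: brace_ideal_def normal_def) (simp add: brace_quotient_def)
  hence sub: "?J \<subseteq> socle_series A (Suc n)"
    using coset_eq_iff[OF J, THEN iffD2] subgroup.mem_carrier[OF sJ] by fastforce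
  have img: "(\<lambda>x. ?J +> x) ` socle_series A (Suc n) = ?S"
    by (auto simp: brace_socle_def quotient_carrier)
  have uniq: "I = socle_series A (Suc n)"
    if I: "brace_ideal I A" "?J \<subseteq> I" and eq: "(\<lambda>x. ?J +> x) ` I = ?S"
  proof -
    have sI: "subgroup I A" using I by (simp add: brace_ideal_def normal_def)
    have "x \<in> I" if x: "x \<in> carrier A" "?J +> x \<in> ?S" for x
    proof -
      obtain y where y: "y \<in> I" "?J +> x = ?J +> y" using x(2) eq by blast
      have yc: "y \<in> carrier A" using y(1) by (rule subgroup.mem_carrier[OF sI])
      have "x \<in> ?J #> x" using rcos_self[OF x(1) sJ] .
      hence "x \<in> ?J #> y" using y(2) x(1) yc by (simp add: coset_eq_coset[OF J])
      then obtain j where "j \<in> ?J" "x = j \<otimes> y" by (auto simp: r_coset_def)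
      thus ?thesis using I(2) y(1) subgroup.m_closed[OF sI] by auto
    qed
    thus ?thesis using eq subgroup.mem_carrier[OF sI] by auto
  qed
  show ?thesis using ideal_socle_series[of "Suc n"] sub img uniq by blast
qed

end

end

theory Submission
  imports Defs "HOL-Library.Product_Plus"
begin

text \<open>
  A left brace is an abelian group \<open>V\<close> with a map \<open>\<lambda>\<close> into its automorphisms satisfying
  \<open>\<lambda>\<^sub>a \<lambda>\<^sub>b = \<lambda>\<^sub>c\<close> for \<open>c = a + \<lambda>\<^sub>a b\<close>, and it is perfect iff the multiplicative group has trivial
  coinvariants on \<open>V\<close>. If \<open>A\<close> is a perfect left brace and \<open>M\<close> is a faithful module for its
  multiplicative group with trivial coinvariants, then the semidirect product \<open>E\<close> of the trivial
  brace \<open>M\<close> by \<open>A\<close> is perfect, its socle is exactly \<open>M\<close>, and \<open>E / M = A\<close>; so the socle series of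
  \<open>E\<close> is that of \<open>A\<close> shifted by one. For finite nonzero \<open>A\<close> such an \<open>M\<close> is the module of zero-sum
  functions from \<open>A\<close> to the integers modulo \<open>|A| + 1\<close>. Iterating from a perfect left brace of order
  24 gives arbitrarily long strictly increasing socle series.
\<close>

section \<open>The socle series of a left brace\<close>

lemma (in left_brace) add_comm: "a \<in> carrier A \<Longrightarrow> b \<in> carrier A \<Longrightarrow> a \<oplus> b = b \<oplus> a"
  using comm_group.axioms(1)[OF add_comm_group] comm_monoid.m_comm[of "add_monoid A" a b] by simp

lemma (in skew_left_brace) brace_star_closed:
  "a \<in> carrier A \<Longrightarrow> b \<in> carrier A \<Longrightarrow> brace_star A a b \<in> carrier A"
  by (simp add: brace_star_def a_minus_def)

lemma (in skew_left_brace) brace_star_zero: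
  assumes a: "a \<in> carrier A"
  shows "brace_star A a \<zero> = \<zero>"
proof -
  have *: "a \<otimes> \<zero> = a" using r_one[OF a] by (simp only: zero_eq_one)
  show ?thesis using a add.inv_one by (simp add: brace_star_def a_minus_def *)
qed

lemma (in skew_left_brace) brace_zero_star:
  assumes a: "a \<in> carrier A"
  shows "brace_star A \<zero> a = \<zero>"
proof -
  have *: "\<zero> \<otimes> a = a" using l_one[OF a] by (simp only: zero_eq_one)
  show ?thesis using a add.inv_one by (simp add: brace_star_def a_minus_def *)
qed

lemma (in left_brace) star_eq:
  assumes "a \<in> carrier A" "b \<in> carrier A"
  shows "brace_star A a b = a \<otimes> b \<ominus> (a \<oplus> b)"
proof -
  have "\<ominus> (a \<oplus> b) = \<ominus> a \<oplus> \<ominus> b"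
    using assms add.inv_mult_group[of a b] add_comm[of "\<ominus> a" "\<ominus> b"] by simp
  thus ?thesis using assms add_comm[of "\<ominus> a" "a \<otimes> b"]
    by (simp add: brace_star_def a_minus_def add.m_assoc)
qed

lemma (in skew_left_brace) coset_eq_coset_iff:
  assumes I: "brace_ideal I A" and "a \<in> carrier A" "b \<in> carrier A"
  shows "I +> a = I +> b \<longleftrightarrow> a \<ominus> b \<in> I"
proof -
  interpret IP: normal I "add_monoid A" using I by (simp add: brace_ideal_def)
  have "a \<in> I +> b \<longleftrightarrow> a \<ominus> b \<in> I"
    using IP.rcos_module[OF add_group, of b a] assms
    by (simp add: a_r_coset_def a_minus_def a_inv_def)
  moreover have "a \<in> I +> b \<longleftrightarrow> I +> a = I +> b"
    using add.repr_independence[of a I b] add.rcos_self[of a I] assms IP.subgroup_axioms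
    by auto
  ultimately show ?thesis by simp
qed

text \<open>Modulo the ideal \<open>socle_series A n\<close>, the two operations agree on
  \<open>x\<close> and \<open>a\<close> exactly when their difference, the star product, lies in the
  ideal; commutation in the quotient is automatic. Cosets thus drop out of all later
  arguments.\<close>

lemma (in left_brace) socle_series_Suc_iff:
  "x \<in> socle_series A (Suc n) \<longleftrightarrow>
    x \<in> carrier A \<and> (\<forall>a\<in>carrier A. brace_star A x a \<in> socle_series A n)"
proof -
  let ?I = "socle_series A n"
  note I = ideal_socle_series[of n]
  have "?I +> x \<in> brace_socle (brace_quotient A ?I) \<longleftrightarrow>
    (\<forall>a\<in>carrier A. ?I +> (x \<otimes> a) = ?I +> (x \<oplus> a) \<and> ?I +> (x \<oplus> a) = ?I +> (a \<oplus> x))"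
    if "x \<in> carrier A"
    using that
    by (auto simp: brace_socle_def quotient_carrier quotient_mult[OF I] quotient_add[OF I])
      (metis quotient_mult[OF I] quotient_add[OF I])+
  thus ?thesis by (auto simp: add_comm star_eq coset_eq_coset_iff[OF I])
qed

text \<open>Were the socle of the quotient zero, its preimage would be the kernel of the canonical
  map, so the series would stop growing. It therefore suffices to exhibit strict growth.\<close>

lemma (in left_brace) socle_quotient_nontrivial:
  assumes "socle_series A (Suc n) \<noteq> socle_series A n"
  shows "brace_socle (brace_quotient A (socle_series A n))
    \<noteq> {\<zero>\<^bsub>brace_quotient A (socle_series A n)\<^esub>}"
proof
  let ?I = "socle_series A n"
  note I = ideal_socle_series[of n]
  assume *: "brace_socle (brace_quotient A ?I) = {\<zero>\<^bsub>brace_quotient A ?I\<^esub>}"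
  have "?I \<subseteq> carrier A"
    using I by (simp add: brace_ideal_def normal_def subgroup.subset)
  hence "{x \<in> carrier A. ?I +> x = ?I} = ?I"
    using coset_eq_iff[OF I] by blast
  moreover have "socle_series A (Suc n) = {x \<in> carrier A. ?I +> x = ?I}"
    by (simp add: *) (simp add: brace_quotient_def)
  ultimately have "socle_series A (Suc n) = ?I" by simp
  with assms show False ..
qed

section \<open>Surjective brace homomorphisms and the socle series\<close>

definition brace_epi :: "('a \<Rightarrow> 'b) \<Rightarrow> ('a, 'm) ring_scheme \<Rightarrow> ('b, 'n) ring_scheme \<Rightarrow> bool"
  where "brace_epi f A B \<longleftrightarrow>
    f \<in> hom A B \<and> f \<in> hom (add_monoid A) (add_monoid B) \<and> f ` carrier A = carrier B"

lemma brace_epi_star: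
  assumes f: "brace_epi f A B" and "skew_left_brace A" "skew_left_brace B"
    and "a \<in> carrier A" "b \<in> carrier A"
  shows "f (brace_star A a b) = brace_star B (f a) (f b)"
proof -
  interpret A: skew_left_brace A by fact
  interpret B: skew_left_brace B by fact
  interpret h: group_hom "add_monoid A" "add_monoid B" f
    using f A.add_group B.add_group by (simp add: group_hom_def group_hom_axioms_def brace_epi_def)
  have m: "f (\<ominus>\<^bsub>A\<^esub> x) = \<ominus>\<^bsub>B\<^esub> f x" if "x \<in> carrier A" for x
    using h.hom_inv[of x] that by (simp add: a_inv_def)
  have "f (a \<otimes>\<^bsub>A\<^esub> b) = f a \<otimes>\<^bsub>B\<^esub> f b"
    using f assms by (auto simp: brace_epi_def hom_def)
  thus ?thesis
    using h.hom_mult assms by (simp add: brace_star_def a_minus_def m)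
qed

text \<open>The premise \<open>base\<close> says that the kernel of \<open>f\<close> is the
  \<open>k\<close>-th socle of \<open>A\<close>. The step transfers star products along
  \<open>f\<close>, surjectivity matching the quantifiers over both carriers. The case
  \<open>k = 1\<close> serves the projection of the semidirect product, \<open>k = 0\<close>
  isomorphic copies.\<close>

lemma socle_series_epi:
  assumes f: "brace_epi f A B" and A: "left_brace A" and B: "left_brace B"
    and base: "\<And>x. x \<in> carrier A \<Longrightarrow> x \<in> socle_series A k \<longleftrightarrow> f x \<in> socle_series B 0"
    and x: "x \<in> carrier A"
  shows "x \<in> socle_series A (n + k) \<longleftrightarrow> f x \<in> socle_series B n"
  using x
proof (induction n arbitrary: x)
  case 0
  show ?case using base[OF 0] by simp
next
  case (Suc n)
  interpret A: left_brace A by fact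
  interpret B: left_brace B by fact
  have im: "carrier B = f ` carrier A" using f by (simp add: brace_epi_def)
  show ?case
    using Suc brace_epi_star[OF f A.skew_left_brace_axioms B.skew_left_brace_axioms]
    by (simp add: A.socle_series_Suc_iff B.socle_series_Suc_iff im A.brace_star_closed
        del: socle_series.simps)
qed

lemma socle_series_strict_epi:
  assumes f: "brace_epi f A B" and A: "left_brace A" and B: "left_brace B"
    and base: "\<And>x. x \<in> carrier A \<Longrightarrow> x \<in> socle_series A k \<longleftrightarrow> f x \<in> socle_series B 0"
    and strict: "socle_series B (Suc n) \<noteq> socle_series B n"
  shows "socle_series A (Suc n + k) \<noteq> socle_series A (n + k)"
proof -
  interpret B: left_brace B by fact
  have sub: "socle_series B j \<subseteq> f ` carrier A" for j
    using f B.ideal_socle_series[of j]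
    by (simp add: brace_ideal_def normal_def brace_epi_def subgroup.subset)
  from strict sub obtain x where "x \<in> carrier A"
    "f x \<in> socle_series B (Suc n) \<longleftrightarrow> f x \<notin> socle_series B n"
    by blast
  thus ?thesis using socle_series_epi[OF f A B base, of x] by blast
qed

text \<open>Star products map onto star products, and a homomorphism commutes with generation of
  subgroups.\<close>

lemma perfect_brace_epi:
  assumes f: "brace_epi f A B" and "skew_left_brace A" "skew_left_brace B" "perfect_brace A"
  shows "perfect_brace B"
proof -
  interpret A: skew_left_brace A by fact
  interpret B: skew_left_brace B by fact
  interpret h: group_hom "add_monoid A" "add_monoid B" f
    using f A.add_group B.add_group by (simp add: group_hom_def group_hom_axioms_def brace_epi_def)
  have im: "f ` carrier A = carrier B" using f by (simp add: brace_epi_def)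
  let ?K = "{brace_star A a b | a b. a \<in> carrier A \<and> b \<in> carrier A}"
  have "f ` ?K = {brace_star B a b | a b. a \<in> carrier B \<and> b \<in> carrier B}"
  proof (intro equalityI subsetI)
    fix y assume "y \<in> f ` ?K"
    thus "y \<in> {brace_star B a b | a b. a \<in> carrier B \<and> b \<in> carrier B}"
      using brace_epi_star[OF f assms(2,3)] im by blast
  next
    fix y assume "y \<in> {brace_star B a b | a b. a \<in> carrier B \<and> b \<in> carrier B}"
    then obtain a b where "a \<in> carrier A" "b \<in> carrier A" "y = brace_star B (f a) (f b)"
      unfolding im[symmetric] by blast
    thus "y \<in> f ` ?K"
      using brace_epi_star[OF f assms(2,3), of a b]
      by (intro image_eqI[of _ _ "brace_star A a b"]) auto
  qed
  moreover have "f ` generate (add_monoid A) ?K = generate (add_monoid B) (f ` ?K)"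
    by (rule h.generate_img[symmetric]) (auto intro: A.brace_star_closed)
  ultimately show ?thesis using assms(4) im by (simp add: perfect_brace_def brace_square_def)
qed

section \<open>Left braces from an abelian group and its lambda map\<close>

definition brace_of :: "'a monoid \<Rightarrow> ('a \<Rightarrow> 'a \<Rightarrow> 'a) \<Rightarrow> 'a ring"
  where "brace_of V l = \<lparr>carrier = carrier V, mult = (\<lambda>a b. a \<otimes>\<^bsub>V\<^esub> l a b), one = \<one>\<^bsub>V\<^esub>,
    zero = \<one>\<^bsub>V\<^esub>, add = mult V\<rparr>"

lemma brace_of_simps [simp]:
  "carrier (brace_of V l) = carrier V" "\<zero>\<^bsub>brace_of V l\<^esub> = \<one>\<^bsub>V\<^esub>" "\<one>\<^bsub>brace_of V l\<^esub> = \<one>\<^bsub>V\<^esub>"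
  "a \<otimes>\<^bsub>brace_of V l\<^esub> b = a \<otimes>\<^bsub>V\<^esub> l a b" "add (brace_of V l) = mult V"
  by (simp_all add: brace_of_def)

lemma monoid_eta [simp]: "\<lparr>carrier = carrier V, mult = mult V, one = \<one>\<^bsub>V\<^esub>\<rparr> = (V :: 'a monoid)"
  by simp

lemma add_monoid_brace_of: "add_monoid (brace_of V l) = V"
  by simp

lemma a_inv_brace_of [simp]: "\<ominus>\<^bsub>brace_of V l\<^esub> a = inv\<^bsub>V\<^esub> a"
  by (simp add: a_inv_def)

text \<open>Here \<open>V\<close> is the additive group written multiplicatively.
  \<open>l_comp\<close> makes the circle operation associative; \<open>l_surj\<close> yields its
  inverses and the triviality of \<open>l \<one>\<close>.\<close>

locale lambda_map = comm_group V for V :: "'a monoid" (structure) +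
  fixes l :: "'a \<Rightarrow> 'a \<Rightarrow> 'a"
  assumes l_closed: "a \<in> carrier V \<Longrightarrow> b \<in> carrier V \<Longrightarrow> l a b \<in> carrier V"
    and l_hom: "a \<in> carrier V \<Longrightarrow> b \<in> carrier V \<Longrightarrow> c \<in> carrier V \<Longrightarrow> l a (b \<otimes> c) = l a b \<otimes> l a c"
    and l_comp: "a \<in> carrier V \<Longrightarrow> b \<in> carrier V \<Longrightarrow> c \<in> carrier V \<Longrightarrow>
      l a (l b c) = l (a \<otimes> l a b) c"
    and l_surj: "a \<in> carrier V \<Longrightarrow> b \<in> carrier V \<Longrightarrow> \<exists>c\<in>carrier V. l a c = b"
begin

lemma l_right_one: "a \<in> carrier V \<Longrightarrow> l a \<one> = \<one>"
  using l_hom[of a \<one> \<one>] l_closed[of a \<one>] l_cancel_one by simp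

text \<open>By \<open>l_comp\<close> the map \<open>l \<one>\<close> is idempotent, and an
  idempotent surjection is the identity.\<close>

lemma l_left_one: "a \<in> carrier V \<Longrightarrow> l \<one> a = a"
  using l_surj[of \<one> a] l_comp[of \<one> \<one>] by (auto simp: l_right_one)

lemma left_brace_brace_of: "left_brace (brace_of V l)"
proof -
  have assoc: "(a \<otimes> l a b) \<otimes> l (a \<otimes> l a b) c = a \<otimes> l a (b \<otimes> l b c)"
    if "a \<in> carrier V" "b \<in> carrier V" "c \<in> carrier V" for a b c
    using that by (simp add: l_closed l_hom l_comp m_assoc)
  have right: "\<exists>y\<in>carrier V. x \<otimes> l x y = \<one>" if "x \<in> carrier V" for x
    using l_surj[of x "inv x"] that by (metis inv_closed r_inv)
  \<comment> \<open>Surjectivity gives right inverses, while \<open>groupI\<close> wants left ones: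
    a right inverse \<open>y\<close> of \<open>x\<close> has a right inverse \<open>z\<close>, and
    associativity forces \<open>x = z\<close>.\<close>
  have left: "\<exists>y\<in>carrier V. y \<otimes> l y x = \<one>" if x: "x \<in> carrier V" for x
  proof -
    obtain y where y: "y \<in> carrier V" "x \<otimes> l x y = \<one>" using right x by blast
    obtain z where z: "z \<in> carrier V" "y \<otimes> l y z = \<one>" using right y by blast
    have "x = x \<otimes> l x (y \<otimes> l y z)" using x by (simp add: z l_right_one)
    also have "\<dots> = z" using assoc[OF x y(1) z(1)] z(1) by (simp add: y l_left_one)
    finally show ?thesis using y z by auto
  qed
  have "group (brace_of V l)"
    by (rule groupI) (auto simp: l_closed assoc l_left_one left)
  moreover have "a \<otimes> l a (b \<otimes> c) = a \<otimes> l a b \<otimes> inv a \<otimes> (a \<otimes> l a c)"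
    if "a \<in> carrier V" "b \<in> carrier V" "c \<in> carrier V" for a b c
    using that inv_solve_left'[of a] by (simp add: l_closed l_hom m_assoc) (simp add: m_assoc[symmetric] l_closed)
  ultimately show ?thesis
    by (simp add: left_brace_def left_brace_axioms_def skew_left_brace_def
        skew_left_brace_axioms_def a_minus_def is_group comm_group_axioms)
qed

lemma star_brace_of:
  assumes "a \<in> carrier V" "b \<in> carrier V"
  shows "brace_star (brace_of V l) a b = l a b \<otimes> inv b"
  using assms by (simp add: brace_star_def a_minus_def l_closed m_assoc[symmetric])

end

section \<open>Semidirect products with a module\<close>

locale brace_module = A: left_brace A + M: comm_group M
  for A :: "'a ring" and M :: "'b monoid" +
  fixes act :: "'a \<Rightarrow> 'b \<Rightarrow> 'b"
  assumes act_closed: "a \<in> carrier A \<Longrightarrow> m \<in> carrier M \<Longrightarrow> act a m \<in> carrier M"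
    and act_hom: "a \<in> carrier A \<Longrightarrow> m \<in> carrier M \<Longrightarrow> n \<in> carrier M \<Longrightarrow>
      act a (m \<otimes>\<^bsub>M\<^esub> n) = act a m \<otimes>\<^bsub>M\<^esub> act a n"
    and act_mult: "a \<in> carrier A \<Longrightarrow> b \<in> carrier A \<Longrightarrow> m \<in> carrier M \<Longrightarrow>
      act (a \<otimes>\<^bsub>A\<^esub> b) m = act a (act b m)"
    and act_one: "m \<in> carrier M \<Longrightarrow> act \<one>\<^bsub>A\<^esub> m = m"
begin

text \<open>Only the brace component of \<open>x\<close> acts, so the elements of \<open>M\<close>
  have trivial lambda map and \<open>M\<close> becomes a trivial brace.\<close>

abbreviation l :: "'b \<times> 'a \<Rightarrow> 'b \<times> 'a \<Rightarrow> 'b \<times> 'a"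
  where "l x y \<equiv> (act (snd x) (fst y), brace_lambda A (snd x) (snd y))"

definition semidirect :: "('b \<times> 'a) ring"
  where "semidirect = brace_of (M \<times>\<times> add_monoid A) l"

sublocale E: lambda_map "M \<times>\<times> add_monoid A" l
proof -
  interpret P: group "M \<times>\<times> add_monoid A"
    by (rule DirProd_group[OF M.is_group A.add_group])
  have "comm_group (M \<times>\<times> add_monoid A)"
    by (rule P.group_comm_groupI) (auto simp: M.m_comm A.add_comm)
  moreover have "\<exists>z\<in>carrier (M \<times>\<times> add_monoid A). l x z = y"
    if "x \<in> carrier (M \<times>\<times> add_monoid A)" "y \<in> carrier (M \<times>\<times> add_monoid A)" for x y
    using that
    by (intro bexI[of _ "l (fst x, inv\<^bsub>A\<^esub> (snd x)) y"])
      (auto simp: act_closed act_mult[symmetric] act_one A.lam_surj A.lam_closed)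
  ultimately show "lambda_map (M \<times>\<times> add_monoid A) l"
    by (auto simp: lambda_map_def lambda_map_axioms_def act_closed act_hom A.lam_closed
        A.lam_add act_mult[symmetric] A.lam_mult[symmetric] A.mult_eq)
qed

lemma act_zero: "a \<in> carrier A \<Longrightarrow> act a \<one>\<^bsub>M\<^esub> = \<one>\<^bsub>M\<^esub>"
  using act_hom[of a "\<one>\<^bsub>M\<^esub>" "\<one>\<^bsub>M\<^esub>"] act_closed[of a "\<one>\<^bsub>M\<^esub>"] M.l_cancel_one by simp

lemma carrier_semidirect: "carrier semidirect = carrier M \<times> carrier A"
  by (simp add: semidirect_def)

lemma left_brace_semidirect: "left_brace semidirect"
  unfolding semidirect_def by (rule E.left_brace_brace_of)

lemma brace_epi_snd: "brace_epi snd semidirect A"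
proof -
  have "snd ` carrier semidirect = carrier A"
    using M.one_closed by (force simp: carrier_semidirect)
  moreover have "snd \<in> hom semidirect A"
    by (rule homI) (auto simp: semidirect_def mult_DirProd' A.mult_eq)
  moreover have "snd \<in> hom (add_monoid semidirect) (add_monoid A)"
    by (rule homI) (auto simp: semidirect_def mult_DirProd')
  ultimately show ?thesis by (simp add: brace_epi_def)
qed

text \<open>Both perfectness and the socle of the semidirect product are read off from this formula;
  note that \<open>m\<close> is absent from the right-hand side.\<close>

lemma star_semidirect:
  assumes "m \<in> carrier M" "a \<in> carrier A" "n \<in> carrier M" "b \<in> carrier A"
  shows "brace_star semidirect (m, a) (n, b) = (act a n \<otimes>\<^bsub>M\<^esub> inv\<^bsub>M\<^esub> n, brace_star A a b)"
proof -
  have "inv\<^bsub>M \<times>\<times> add_monoid A\<^esub> (n, b) = (inv\<^bsub>M\<^esub> n, \<ominus>\<^bsub>A\<^esub> b)"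
    using assms A.add_group by (simp add: inv_DirProd a_inv_def)
  thus ?thesis using assms E.star_brace_of[of "(m, a)" "(n, b)"]
    by (simp add: semidirect_def brace_lambda_def brace_star_def a_minus_def)
qed

text \<open>Star products of \<open>(\<one>, a)\<close> with \<open>(m, \<zero>)\<close> generate
  the module, because \<open>coinv\<close> says that the coinvariants vanish; those of
  \<open>(\<one>, a)\<close> with \<open>(\<one>, b)\<close> generate the brace factor.\<close>

lemma perfect_semidirect:
  assumes "perfect_brace A"
    and coinv: "generate M {act a m \<otimes>\<^bsub>M\<^esub> inv\<^bsub>M\<^esub> m | a m. a \<in> carrier A \<and> m \<in> carrier M} = carrier M"
  shows "perfect_brace semidirect"
proof -
  interpret B: left_brace semidirect by (rule left_brace_semidirect)
  let ?V = "M \<times>\<times> add_monoid A"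
  let ?K = "{brace_star semidirect x y | x y. x \<in> carrier semidirect \<and> y \<in> carrier semidirect}"
  let ?KM = "{act a m \<otimes>\<^bsub>M\<^esub> inv\<^bsub>M\<^esub> m | a m. a \<in> carrier A \<and> m \<in> carrier M}"
  let ?KA = "{brace_star A a b | a b. a \<in> carrier A \<and> b \<in> carrier A}"
  have V: "add_monoid semidirect = ?V" by (simp add: semidirect_def)
  have K: "?K \<subseteq> carrier ?V"
    unfolding carrier_DirProd partial_object.simps carrier_semidirect[symmetric]
    using B.brace_star_closed by blast
  have H: "subgroup (generate ?V ?K) ?V" by (rule E.generate_is_subgroup[OF K])
  interpret i: group_hom M ?V "\<lambda>m. (m, \<zero>\<^bsub>A\<^esub>)"
    by unfold_locales (auto simp: hom_def)
  interpret j: group_hom "add_monoid A" ?V "\<lambda>a. (\<one>\<^bsub>M\<^esub>, a)"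
    by (intro group_hom.intro group_hom_axioms.intro A.add_group E.is_group) (auto simp: hom_def)
  have "(m, \<zero>\<^bsub>A\<^esub>) \<in> generate ?V ?K" if "m \<in> carrier M" for m
  proof -
    have "(\<lambda>m. (m, \<zero>\<^bsub>A\<^esub>)) ` ?KM \<subseteq> ?K"
    proof (clarify)
      fix a m assume am: "a \<in> carrier A" "m \<in> carrier M"
      show "\<exists>x y. (act a m \<otimes>\<^bsub>M\<^esub> inv\<^bsub>M\<^esub> m, \<zero>\<^bsub>A\<^esub>) = brace_star semidirect x y \<and>
          x \<in> carrier semidirect \<and> y \<in> carrier semidirect"
        using am by (intro exI[of _ "(\<one>\<^bsub>M\<^esub>, a)"] exI[of _ "(m, \<zero>\<^bsub>A\<^esub>)"])
          (simp add: star_semidirect carrier_semidirect A.brace_star_zero)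
    qed
    hence "generate ?V ((\<lambda>m. (m, \<zero>\<^bsub>A\<^esub>)) ` ?KM) \<subseteq> generate ?V ?K"
      by (rule E.mono_generate)
    moreover have "(\<lambda>m. (m, \<zero>\<^bsub>A\<^esub>)) ` generate M ?KM = generate ?V ((\<lambda>m. (m, \<zero>\<^bsub>A\<^esub>)) ` ?KM)"
      by (rule i.generate_img[symmetric]) (auto simp: act_closed)
    ultimately show ?thesis using imageI[OF that, of "\<lambda>m. (m, \<zero>\<^bsub>A\<^esub>)"]
      unfolding coinv by auto
  qed
  moreover have "(\<one>\<^bsub>M\<^esub>, a) \<in> generate ?V ?K" if "a \<in> carrier A" for a
  proof -
    have "(\<lambda>a. (\<one>\<^bsub>M\<^esub>, a)) ` ?KA \<subseteq> ?K"
    proof (clarify)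
      fix a b assume ab: "a \<in> carrier A" "b \<in> carrier A"
      show "\<exists>x y. (\<one>\<^bsub>M\<^esub>, brace_star A a b) = brace_star semidirect x y \<and>
          x \<in> carrier semidirect \<and> y \<in> carrier semidirect"
        using ab by (intro exI[of _ "(\<one>\<^bsub>M\<^esub>, a)"] exI[of _ "(\<one>\<^bsub>M\<^esub>, b)"])
          (simp add: star_semidirect carrier_semidirect act_zero)
    qed
    hence "generate ?V ((\<lambda>a. (\<one>\<^bsub>M\<^esub>, a)) ` ?KA) \<subseteq> generate ?V ?K"
      by (rule E.mono_generate)
    moreover have "(\<lambda>a. (\<one>\<^bsub>M\<^esub>, a)) ` generate (add_monoid A) ?KA = generate ?V ((\<lambda>a. (\<one>\<^bsub>M\<^esub>, a)) ` ?KA)"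
      by (rule j.generate_img[symmetric]) (auto intro: A.brace_star_closed)
    ultimately show ?thesis using imageI[OF that, of "Pair \<one>\<^bsub>M\<^esub>"] \<open>perfect_brace A\<close>
      unfolding perfect_brace_def brace_square_def by auto
  qed
  ultimately have "(m, a) \<in> generate ?V ?K" if "m \<in> carrier M" "a \<in> carrier A" for m a
    using subgroup.m_closed[OF H, of "(m, \<zero>\<^bsub>A\<^esub>)" "(\<one>\<^bsub>M\<^esub>, a)"] that by simp
  moreover have "generate ?V ?K \<subseteq> carrier ?V" using subgroup.subset[OF H] .
  ultimately show ?thesis
    unfolding perfect_brace_def brace_square_def V by (auto simp: carrier_semidirect)
qed

text \<open>A socle element must act trivially on \<open>M\<close>, so faithfulness kills its brace
  component; conversely the elements over zero have only zero star products. The first socle is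
  therefore the kernel of \<open>snd\<close>.\<close>

lemma socle_semidirect:
  assumes faithful: "\<And>a. a \<in> carrier A \<Longrightarrow> (\<And>m. m \<in> carrier M \<Longrightarrow> act a m = m) \<Longrightarrow> a = \<one>\<^bsub>A\<^esub>"
    and x: "x \<in> carrier semidirect"
  shows "x \<in> socle_series semidirect 1 \<longleftrightarrow> snd x \<in> socle_series A 0"
proof -
  interpret B: left_brace semidirect by (rule left_brace_semidirect)
  obtain m a where ma: "x = (m, a)" "m \<in> carrier M" "a \<in> carrier A"
    using x by (auto simp: carrier_semidirect)
  have zero: "\<zero>\<^bsub>semidirect\<^esub> = (\<one>\<^bsub>M\<^esub>, \<zero>\<^bsub>A\<^esub>)" by (simp add: semidirect_def)
  have "x \<in> socle_series semidirect 1 \<longleftrightarrow> (\<forall>n\<in>carrier M. \<forall>b\<in>carrier A.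
      act a n \<otimes>\<^bsub>M\<^esub> inv\<^bsub>M\<^esub> n = \<one>\<^bsub>M\<^esub> \<and> brace_star A a b = \<zero>\<^bsub>A\<^esub>)"
    using ma B.socle_series_Suc_iff[of x 0]
    by (auto simp: carrier_semidirect star_semidirect zero simp del: socle_series.simps(2))
  also have "\<dots> \<longleftrightarrow> a = \<zero>\<^bsub>A\<^esub>"
  proof
    assume *: "\<forall>n\<in>carrier M. \<forall>b\<in>carrier A.
      act a n \<otimes>\<^bsub>M\<^esub> inv\<^bsub>M\<^esub> n = \<one>\<^bsub>M\<^esub> \<and> brace_star A a b = \<zero>\<^bsub>A\<^esub>"
    have "act a n = n" if n: "n \<in> carrier M" for n
    proof -
      have "act a n \<otimes>\<^bsub>M\<^esub> inv\<^bsub>M\<^esub> n = \<one>\<^bsub>M\<^esub>" using * n A.one_closed by blast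
      thus ?thesis using n M.inv_solve_right'[of "\<one>\<^bsub>M\<^esub>" "act a n" n] by (simp add: act_closed ma)
    qed
    thus "a = \<zero>\<^bsub>A\<^esub>" using faithful ma by (simp add: A.zero_eq_one)
  next
    assume a: "a = \<zero>\<^bsub>A\<^esub>"
    have "act \<zero>\<^bsub>A\<^esub> n = n" if "n \<in> carrier M" for n
      using act_one[OF that] by (simp only: A.zero_eq_one)
    thus "\<forall>n\<in>carrier M. \<forall>b\<in>carrier A.
      act a n \<otimes>\<^bsub>M\<^esub> inv\<^bsub>M\<^esub> n = \<one>\<^bsub>M\<^esub> \<and> brace_star A a b = \<zero>\<^bsub>A\<^esub>"
      by (simp add: a A.brace_zero_star)
  qed
  finally show ?thesis by (simp add: ma)
qed

end

section \<open>The augmentation module\<close>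

definition coeff_mod :: "'a ring \<Rightarrow> int"
  where "coeff_mod A = int (card (carrier A)) + 1"

text \<open>This is the augmentation ideal of the group ring of the multiplicative group over the
  integers modulo \<open>coeff_mod A\<close>. Reduced residues and the value 0 off the carrier make
  representatives unique.\<close>

definition aug_module :: "'a ring \<Rightarrow> ('a \<Rightarrow> int) monoid"
  where "aug_module A =
    \<lparr>carrier = {f. (\<forall>x. (x \<in> carrier A \<longrightarrow> f x \<in> {0..<coeff_mod A}) \<and> (x \<notin> carrier A \<longrightarrow> f x = 0)) \<and>
        coeff_mod A dvd (\<Sum>x\<in>carrier A. f x)},
      mult = (\<lambda>f g x. (f x + g x) mod coeff_mod A), one = (\<lambda>_. 0)\<rparr>"

definition translate :: "'a ring \<Rightarrow> 'a \<Rightarrow> ('a \<Rightarrow> int) \<Rightarrow> 'a \<Rightarrow> int"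
  where "translate A a f x = (if x \<in> carrier A then f (inv\<^bsub>A\<^esub> a \<otimes>\<^bsub>A\<^esub> x) else 0)"

lemma aug_module_simps [simp]:
  "f \<otimes>\<^bsub>aug_module A\<^esub> g = (\<lambda>x. (f x + g x) mod coeff_mod A)" "\<one>\<^bsub>aug_module A\<^esub> = (\<lambda>_. 0)"
  by (simp_all add: aug_module_def)

lemma coeff_mod_pos [simp]: "coeff_mod A > 0"
  by (simp add: coeff_mod_def)

lemma aug_module_iff:
  "f \<in> carrier (aug_module A) \<longleftrightarrow>
    (\<forall>x. f x mod coeff_mod A = f x) \<and> (\<forall>x. x \<notin> carrier A \<longrightarrow> f x = 0) \<and>
    coeff_mod A dvd (\<Sum>x\<in>carrier A. f x)"
proof -
  have range: "c \<in> {0..<coeff_mod A} \<longleftrightarrow> c mod coeff_mod A = c" for c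
    using pos_mod_bound[of "coeff_mod A" c] pos_mod_sign[of "coeff_mod A" c]
    by (metis atLeastLessThan_iff coeff_mod_pos mod_pos_pos_trivial)
  show ?thesis
    unfolding aug_module_def partial_object.select_convs mem_Collect_eq range by (metis mod_0)
qed

lemma dvd_sum_mod: "(m :: int) dvd (\<Sum>x\<in>S. h x mod m) \<longleftrightarrow> m dvd (\<Sum>x\<in>S. h x)"
  by (simp add: dvd_eq_mod_eq_0 mod_sum_eq)

lemma comm_group_aug_module: "comm_group (aug_module A)"
proof (rule comm_groupI)
  fix f assume f: "f \<in> carrier (aug_module A)"
  show "\<exists>g\<in>carrier (aug_module A). g \<otimes>\<^bsub>aug_module A\<^esub> f = \<one>\<^bsub>aug_module A\<^esub>"
    using f by (intro bexI[of _ "\<lambda>x. (- f x) mod coeff_mod A"])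
      (auto simp: aug_module_iff dvd_sum_mod sum_negf mod_simps)
qed (auto simp: aug_module_iff dvd_sum_mod sum.distrib mod_simps ac_simps)

lemma inv_aug_module:
  assumes "f \<in> carrier (aug_module A)"
  shows "inv\<^bsub>aug_module A\<^esub> f = (\<lambda>x. (- f x) mod coeff_mod A)"
proof -
  interpret M: comm_group "aug_module A" by (rule comm_group_aug_module)
  show ?thesis using assms
    by (intro M.inv_equality) (auto simp: aug_module_iff dvd_sum_mod sum_negf mod_simps)
qed

lemma finite_aug_module:
  assumes "finite (carrier A)"
  shows "finite (carrier (aug_module A))"
  using finite_set_of_finite_funs[OF assms finite_atLeastLessThan_int[of 0 "coeff_mod A"], of 0]
  by (rule rev_finite_subset) (auto simp: aug_module_def)

lemma (in group) sum_translate: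
  assumes "a \<in> carrier G"
  shows "(\<Sum>x\<in>carrier G. f (inv a \<otimes> x)) = (\<Sum>x\<in>carrier G. f x)"
  using assms
  by (intro sum.reindex_bij_witness[of _ "\<lambda>x. a \<otimes> x" "\<lambda>x. inv a \<otimes> x"])
    (simp_all add: m_assoc[symmetric])

text \<open>For fixed \<open>x\<close>, the map sending \<open>a\<close> to
  \<open>inv a \<otimes> x\<close> permutes the group. Thus the translates of a function, summed at
  one point, give its total sum.\<close>

lemma (in group) sum_inv_mult:
  assumes "x \<in> carrier G"
  shows "(\<Sum>a\<in>carrier G. f (inv a \<otimes> x)) = (\<Sum>a\<in>carrier G. f a)"
  using assms
  by (intro sum.reindex_bij_witness[of _ "\<lambda>a. x \<otimes> inv a" "\<lambda>a. inv a \<otimes> x"])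
    (simp_all add: inv_mult_group m_assoc[symmetric], simp_all add: m_assoc)

lemma brace_module_aug:
  assumes "left_brace A"
  shows "brace_module A (aug_module A) (translate A)"
proof -
  interpret A: left_brace A by fact
  show ?thesis
  proof (intro brace_module.intro brace_module_axioms.intro assms comm_group_aug_module)
    fix a f assume a: "a \<in> carrier A" and f: "f \<in> carrier (aug_module A)"
    show "translate A a f \<in> carrier (aug_module A)"
      using a f A.sum_translate[OF a, of f] by (auto simp: aug_module_iff translate_def)
  next
    fix f assume f: "f \<in> carrier (aug_module A)"
    show "translate A \<one>\<^bsub>A\<^esub> f = f"
      using f by (auto simp: aug_module_iff translate_def fun_eq_iff)
  next
    fix a b f assume "a \<in> carrier A" "b \<in> carrier A"
    thus "translate A (a \<otimes>\<^bsub>A\<^esub> b) f = translate A a (translate A b f)"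
      by (auto simp: translate_def fun_eq_iff A.inv_mult_group A.m_assoc)
  qed (auto simp: translate_def fun_eq_iff)
qed

text \<open>
  Since the order of \<open>A\<close> is \<open>-1\<close> modulo \<open>coeff_mod A\<close>, and the translates of a function \<open>f\<close> with
  zero sum add up to zero, \<open>f\<close> is the sum of all \<open>translate A a f - f\<close>.
\<close>

lemma aug_module_coinvariants:
  assumes "left_brace A" and fin: "finite (carrier A)"
  shows "generate (aug_module A) {translate A a f \<otimes>\<^bsub>aug_module A\<^esub> inv\<^bsub>aug_module A\<^esub> f | a f.
    a \<in> carrier A \<and> f \<in> carrier (aug_module A)} = carrier (aug_module A)"
    (is "generate _ ?K = _")
proof
  interpret A: left_brace A by fact
  interpret M: brace_module A "aug_module A" "translate A" by (rule brace_module_aug[OF assms(1)])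
  let ?m = "coeff_mod A"
  have "?K \<subseteq> carrier (aug_module A)"
    using M.act_closed M.M.m_closed M.M.inv_closed by blast
  thus "generate (aug_module A) ?K \<subseteq> carrier (aug_module A)"
    by (rule M.M.generate_incl)
  show "carrier (aug_module A) \<subseteq> generate (aug_module A) ?K"
  proof
    fix f assume f: "f \<in> carrier (aug_module A)"
    \<comment> \<open>The sum is stated over arbitrary finite subsets so that it can be built in the
      generated subgroup one summand at a time.\<close>
    have partial: "(\<lambda>x. (\<Sum>a\<in>T. translate A a f x - f x) mod ?m) \<in> generate (aug_module A) ?K"
      if "finite T" "T \<subseteq> carrier A" for T
      using that
    proof (induction T)
      case empty
      show ?case using generate.one[of "aug_module A" ?K] by simp
    next
      case (insert a T)
      let ?g = "translate A a f \<otimes>\<^bsub>aug_module A\<^esub> inv\<^bsub>aug_module A\<^esub> f"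
      let ?h = "\<lambda>x. (\<Sum>a\<in>T. translate A a f x - f x) mod ?m"
      have gK: "?g \<in> ?K" using insert.prems f by blast
      have h: "?h \<in> generate (aug_module A) ?K" using insert.IH insert.prems by blast
      have "?g \<otimes>\<^bsub>aug_module A\<^esub> ?h \<in> generate (aug_module A) ?K"
        by (rule generate.eng[OF generate.incl[OF gK] h])
      moreover have "?g \<otimes>\<^bsub>aug_module A\<^esub> ?h
          = (\<lambda>x. (\<Sum>a\<in>insert a T. translate A a f x - f x) mod ?m)"
        using insert f by (simp add: inv_aug_module mod_simps)
      ultimately show ?case by simp
    qed
    have "(\<Sum>a\<in>carrier A. translate A a f x - f x) mod ?m = f x" for x
    proof (cases "x \<in> carrier A")
      case True
      \<comment> \<open>Subtracting \<open>f x\<close> once for each of the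
        \<open>coeff_mod A - 1\<close> elements leaves \<open>f x\<close> modulo
        \<open>coeff_mod A\<close>.\<close>
      have "(\<Sum>a\<in>carrier A. translate A a f x - f x)
          = (\<Sum>a\<in>carrier A. f a) + f x - ?m * f x"
        using A.sum_inv_mult[OF True, of f] True
        by (simp add: translate_def sum_subtractf coeff_mod_def algebra_simps)
      moreover obtain k where "(\<Sum>a\<in>carrier A. f a) = ?m * k"
        using f unfolding aug_module_iff by (blast elim: dvdE)
      moreover have "?m * k + f x - ?m * f x = f x + ?m * (k - f x)"
        by (simp add: algebra_simps)
      ultimately show ?thesis using f by (simp add: aug_module_iff)
    next
      case False
      thus ?thesis using f by (simp add: aug_module_iff translate_def)
    qed
    thus "f \<in> generate (aug_module A) ?K" using partial[OF fin] by simp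
  qed
qed

lemma aug_module_faithful:
  assumes "left_brace A" and fin: "finite (carrier A)"
    and a: "a \<in> carrier A" "a \<noteq> \<one>\<^bsub>A\<^esub>"
  shows "\<exists>f\<in>carrier (aug_module A). translate A a f \<noteq> f"
proof -
  interpret A: left_brace A by fact
  have "card {\<one>\<^bsub>A\<^esub>, a} \<le> card (carrier A)"
    using a by (intro card_mono fin) auto
  hence m: "coeff_mod A \<ge> 3" using a(2) by (simp add: coeff_mod_def)
  \<comment> \<open>The difference of the point masses at \<open>\<one>\<close> and
    \<open>a\<close>. At \<open>a\<close> its translate has value 1 but \<open>f\<close> has value
    -1; these differ because the modulus is at least 3.\<close>
  define f where "f = (\<lambda>x. if x = \<one>\<^bsub>A\<^esub> then 1 else if x = a then coeff_mod A - 1 else 0)"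
  have "(\<Sum>x\<in>carrier A. f x) = (\<Sum>x\<in>{\<one>\<^bsub>A\<^esub>, a}. f x)"
    using a by (intro sum.mono_neutral_right fin) (auto simp: f_def)
  also have "\<dots> = coeff_mod A" using a by (simp add: f_def)
  finally have "f \<in> carrier (aug_module A)"
    using m a by (auto simp: aug_module_iff f_def)
  moreover have "translate A a f a \<noteq> f a"
    using a m by (simp add: translate_def f_def)
  ultimately show ?thesis by metis
qed

section \<open>Lengthening the socle series by one step\<close>

definition nonzero_perfect_brace :: "'a ring \<Rightarrow> bool"
  where "nonzero_perfect_brace A \<longleftrightarrow>
    left_brace A \<and> finite (carrier A) \<and> perfect_brace A \<and> carrier A \<noteq> {\<zero>\<^bsub>A\<^esub>}"

text \<open>The semidirect product with the augmentation module works: its first socle is the kernel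
  of the projection to \<open>A\<close>, so every strict step of \<open>A\<close> reappears one
  place later. The new first step is strict because \<open>A\<close>, and hence the module, is
  nonzero.\<close>

lemma socle_series_extension:
  fixes A :: "'a ring"
  assumes "nonzero_perfect_brace A"
  shows "\<exists>E :: (('a \<Rightarrow> int) \<times> 'a) ring. nonzero_perfect_brace E \<and>
    socle_series E 1 \<noteq> socle_series E 0 \<and>
    (\<forall>n. socle_series A (Suc n) \<noteq> socle_series A n \<longrightarrow>
      socle_series E (Suc (Suc n)) \<noteq> socle_series E (Suc n))"
proof -
  have A: "left_brace A" "finite (carrier A)" "perfect_brace A" "carrier A \<noteq> {\<zero>\<^bsub>A\<^esub>}"
    using assms by (auto simp: nonzero_perfect_brace_def)
  interpret A: left_brace A by fact
  interpret M: brace_module A "aug_module A" "translate A" by (rule brace_module_aug[OF A(1)])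
  let ?E = "M.semidirect"
  interpret E: left_brace ?E by (rule M.left_brace_semidirect)
  have socle: "x \<in> socle_series ?E 1 \<longleftrightarrow> snd x \<in> socle_series A 0" if "x \<in> carrier ?E" for x
    using aug_module_faithful[OF A(1,2)] that by (intro M.socle_semidirect) auto
  have "carrier A \<noteq> {\<one>\<^bsub>A\<^esub>}" using A(4) by (simp only: A.zero_eq_one not_False_eq_True)
  hence "\<not> carrier A \<subseteq> {\<one>\<^bsub>A\<^esub>}" using A.one_closed by (metis empty_iff subset_singletonD)
  then obtain a where a: "a \<in> carrier A" "a \<noteq> \<one>\<^bsub>A\<^esub>" by blast
  \<comment> \<open>A function moved by \<open>a\<close> cannot be the neutral element, which every
    translation fixes.\<close>
  obtain f where f: "f \<in> carrier (aug_module A)" "f \<noteq> \<one>\<^bsub>aug_module A\<^esub>"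
    using aug_module_faithful[OF A(1,2) a] M.act_zero[OF a(1)] by metis
  let ?x = "(f, \<zero>\<^bsub>A\<^esub>)"
  have x: "?x \<in> carrier ?E" "?x \<noteq> \<zero>\<^bsub>?E\<^esub>"
    using f by (auto simp: M.carrier_semidirect) (auto simp: M.semidirect_def)
  have "?x \<in> socle_series ?E 1" using socle[OF x(1)] by simp
  hence one: "socle_series ?E 1 \<noteq> socle_series ?E 0" using x(2) by auto
  have "nonzero_perfect_brace ?E"
    using x A(2) M.perfect_semidirect[OF A(3) aug_module_coinvariants[OF A(1,2)]] finite_aug_module
    by (auto simp: nonzero_perfect_brace_def E.left_brace_axioms M.carrier_semidirect)
  moreover have "socle_series ?E (Suc (Suc n)) \<noteq> socle_series ?E (Suc n)"
    if "socle_series A (Suc n) \<noteq> socle_series A n" for n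
    using socle_series_strict_epi[OF M.brace_epi_snd E.left_brace_axioms A(1) socle that] by simp
  ultimately show ?thesis using one by blast
qed

section \<open>Transport to the natural numbers\<close>

definition brace_copy :: "('a \<Rightarrow> 'b) \<Rightarrow> 'a ring \<Rightarrow> 'b ring"
  where "brace_copy f A = (let g = inv_into (carrier A) f in
    \<lparr>carrier = f ` carrier A, mult = (\<lambda>x y. f (g x \<otimes>\<^bsub>A\<^esub> g y)), one = f \<one>\<^bsub>A\<^esub>,
     zero = f \<zero>\<^bsub>A\<^esub>, add = (\<lambda>x y. f (g x \<oplus>\<^bsub>A\<^esub> g y))\<rparr>)"

context
  fixes A :: "'a ring" and f :: "'a \<Rightarrow> 'b"
  assumes A: "left_brace A" and inj: "inj_on f (carrier A)"
begin

interpretation A: left_brace A by (rule A)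

lemma brace_copy_simps:
  "carrier (brace_copy f A) = f ` carrier A" "\<zero>\<^bsub>brace_copy f A\<^esub> = f \<zero>\<^bsub>A\<^esub>" "\<one>\<^bsub>brace_copy f A\<^esub> = f \<one>\<^bsub>A\<^esub>"
  "a \<in> carrier A \<Longrightarrow> b \<in> carrier A \<Longrightarrow> f a \<otimes>\<^bsub>brace_copy f A\<^esub> f b = f (a \<otimes>\<^bsub>A\<^esub> b)"
  "a \<in> carrier A \<Longrightarrow> b \<in> carrier A \<Longrightarrow> f a \<oplus>\<^bsub>brace_copy f A\<^esub> f b = f (a \<oplus>\<^bsub>A\<^esub> b)"
  using inj by (simp_all add: brace_copy_def Let_def)

lemma brace_epi_copy: "brace_epi f A (brace_copy f A)"
  by (auto simp: brace_epi_def hom_def brace_copy_simps)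

text \<open>\<open>socle_series_strict_epi\<close> carries strictness from target to source, so the
  copy has to be the source.\<close>

lemma brace_epi_copy_inv: "brace_epi (inv_into (carrier A) f) (brace_copy f A) A"
  using inj by (auto simp: brace_epi_def hom_def brace_copy_simps image_image)

lemma left_brace_copy: "left_brace (brace_copy f A)"
proof -
  let ?B = "brace_copy f A"
  \<comment> \<open>These record updates change nothing; they match the form in which the image of a
    group under a homomorphism is known to be a group.\<close>
  have "?B\<lparr>carrier := f ` carrier A, one := f \<one>\<^bsub>A\<^esub>\<rparr> = ?B"
    by (simp add: brace_copy_def Let_def)
  hence gM: "group ?B"
    using A.hom_imp_img_group[of f ?B] brace_epi_copy by (simp add: brace_epi_def)
  have "(add_monoid ?B)\<lparr>carrier := f ` carrier (add_monoid A), one := f \<one>\<^bsub>add_monoid A\<^esub>\<rparr> = add_monoid ?B"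
    by (simp add: brace_copy_def Let_def)
  hence gP: "comm_group (add_monoid ?B)"
    using comm_group.hom_imp_img_comm_group[OF A.add_comm_group, of f "add_monoid ?B"] brace_epi_copy
    by (simp add: brace_epi_def)
  hence h: "group_hom (add_monoid A) (add_monoid ?B) f"
    using brace_epi_copy A.add_group
    by (simp add: group_hom_def group_hom_axioms_def brace_epi_def comm_group_def)
  have minus: "\<ominus>\<^bsub>?B\<^esub> f a = f (\<ominus>\<^bsub>A\<^esub> a)" if "a \<in> carrier A" for a
    using group_hom.hom_inv[OF h, of a] that by (simp add: a_inv_def)
  show ?thesis
    using gM gP
    by (auto simp: left_brace_def left_brace_axioms_def skew_left_brace_def comm_group.axioms(2)
        skew_left_brace_axioms_def brace_copy_simps minus a_minus_def A.brace_distrib)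
qed

end

text \<open>Each extension changes the element type; copying the finite carrier into
  \<open>nat\<close> keeps the induction within one type.\<close>

lemma nonzero_perfect_brace_nat:
  assumes "nonzero_perfect_brace A"
  shows "\<exists>B :: nat ring. nonzero_perfect_brace B \<and>
    (\<forall>n. socle_series A (Suc n) \<noteq> socle_series A n \<longrightarrow>
      socle_series B (Suc n) \<noteq> socle_series B n)"
proof -
  have A: "left_brace A" "finite (carrier A)" "perfect_brace A" "carrier A \<noteq> {\<zero>\<^bsub>A\<^esub>}"
    using assms by (auto simp: nonzero_perfect_brace_def)
  interpret A: left_brace A by fact
  obtain f :: "'a \<Rightarrow> nat" where f: "inj_on f (carrier A)"
    using finite_imp_inj_to_nat_seg[OF A(2)] by blast
  let ?B = "brace_copy f A" and ?g = "inv_into (carrier A) f"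
  interpret B: left_brace ?B by (rule left_brace_copy[OF A(1) f])
  have "perfect_brace ?B"
    by (rule perfect_brace_epi[OF brace_epi_copy[OF A(1) f]])
      (simp_all add: A A.skew_left_brace_axioms B.skew_left_brace_axioms)
  moreover have "carrier ?B \<noteq> {\<zero>\<^bsub>?B\<^esub>}"
    using A(4) f inj_on_image_eq_iff[OF f, of "carrier A" "{\<zero>\<^bsub>A\<^esub>}"]
    by (simp add: brace_copy_simps[OF A(1) f])
  ultimately have "nonzero_perfect_brace ?B"
    using A(2) by (simp add: nonzero_perfect_brace_def B.left_brace_axioms brace_copy_simps[OF A(1) f])
  moreover have "x \<in> socle_series ?B 0 \<longleftrightarrow> ?g x \<in> socle_series A 0" if "x \<in> carrier ?B" for x
    using that f by (auto simp: brace_copy_simps[OF A(1) f] inj_on_eq_iff)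
  hence "socle_series ?B (Suc n) \<noteq> socle_series ?B n"
    if "socle_series A (Suc n) \<noteq> socle_series A n" for n
    using socle_series_strict_epi[OF brace_epi_copy_inv[OF A(1) f] B.left_brace_axioms A(1) _ that, of 0]
    by simp
  ultimately show ?thesis by blast
qed

section \<open>A perfect left brace of order 24\<close>

type_synonym F2 = Enum.finite_2
type_synonym F3 = Enum.finite_3

lemmas F2_defs = plus_finite_2_def times_finite_2_def uminus_finite_2_def minus_finite_2_def
lemmas F3_defs = plus_finite_3_def uminus_finite_3_def minus_finite_3_def

text \<open>With the basis 1, w of the field with four elements, where \<open>w^2 = 1 + w\<close>,
  this is multiplication by the \<open>t\<close>-th power of \<open>w\<close>.\<close>

definition rot :: "F3 \<Rightarrow> F2 \<times> F2 \<Rightarrow> F2 \<times> F2"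
  where "rot t y = (if t = 0 then y else if t = 1 then (snd y, fst y + snd y)
    else (fst y + snd y, fst y))"

definition flip :: "F2 \<Rightarrow> F2 \<times> F2 \<Rightarrow> F2 \<times> F2"
  where "flip q y = (if q = 0 then y else (snd y, fst y))"

definition sign :: "F2 \<Rightarrow> F3 \<Rightarrow> F3"
  where "sign q s = (if q = 0 then s else - s)"

definition quad :: "F2 \<times> F2 \<Rightarrow> F2"
  where "quad y = fst y * fst y + fst y * snd y + snd y * snd y"

definition polar :: "F2 \<times> F2 \<Rightarrow> F2 \<times> F2 \<Rightarrow> F2"
  where "polar x y = fst x * snd y + snd x * fst y"

text \<open>
  With \<open>Q = quad\<close> the norm form of the field with four elements, the element \<open>a = (x, \<mu>, t)\<close> acts
  on the first component as an element \<open>g\<close> of the symmetric group \<open>S\<^sub>3 = O(Q)\<close>, with flip part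
  \<open>q = \<mu> - Q x\<close>. Invariance of \<open>Q\<close> makes \<open>q\<close> a homomorphism from the multiplicative group.
\<close>

definition lam24 :: "(F2 \<times> F2) \<times> F2 \<times> F3 \<Rightarrow> (F2 \<times> F2) \<times> F2 \<times> F3 \<Rightarrow> (F2 \<times> F2) \<times> F2 \<times> F3"
  where "lam24 = (\<lambda>(x, \<mu>, t) (y, \<nu>, s).
    let q = \<mu> - quad x; z = rot t (flip q y) in (z, \<nu> + polar x z, sign q s))"

lemma rot_flip_add: "rot t (flip q (y + z)) = rot t (flip q y) + rot t (flip q z)"
  by (cases t; cases q; cases y; cases z) (simp_all add: rot_def flip_def algebra_simps)

lemma polar_add: "polar x (y + z) = polar x y + polar x z" "polar (x + y) z = polar x z + polar y z"
  by (simp_all add: polar_def algebra_simps)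

lemma sign_add: "sign q (s + t) = sign q s + sign q t"
  by (simp add: sign_def)

lemma sign_sign: "sign p (sign q s) = sign (p + q) s"
  by (cases p; cases q) (simp_all add: sign_def F2_defs)

lemma quad_add: "quad (x + y) = quad x + quad y + polar x y"
  by (cases x; cases y; cases "fst x"; cases "snd x"; cases "fst y"; cases "snd y")
    (simp_all add: quad_def polar_def F2_defs)

lemma quad_rot_flip: "quad (rot t (flip q y)) = quad y"
  by (cases y; cases "fst y"; cases "snd y"; cases t; cases q)
    (simp_all add: quad_def rot_def flip_def F2_defs)

lemma polar_rot_flip: "polar (rot t (flip q x)) (rot t (flip q y)) = polar x y"
  by (cases x; cases y; cases "fst x"; cases "snd x"; cases "fst y"; cases "snd y"; cases t; cases q)
    (simp_all add: polar_def rot_def flip_def F2_defs)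

text \<open>This is multiplication in the symmetric group as a semidirect product: conjugation by a
  flip inverts rotations.\<close>

lemma rot_flip_comp:
  "rot t (flip p (rot s (flip q y))) = rot (t + sign p s) (flip (p + q) y)"
  by (cases y; cases "fst y"; cases "snd y"; cases t; cases s; cases p; cases q)
    (simp_all add: rot_def flip_def sign_def F2_defs F3_defs)

lemma rot_flip_surj: "\<exists>y. rot t (flip q y) = z"
proof -
  \<comment> \<open>The witness is \<open>flip q\<close> after \<open>rot (- t)\<close>, rewritten
    with the rotation on the outside.\<close>
  have "rot t (flip q (rot (sign q (- t)) (flip q z))) = z"
    by (cases z; cases "fst z"; cases "snd z"; cases t; cases q)
      (simp_all add: rot_def flip_def sign_def F2_defs F3_defs)
  thus ?thesis ..
qed

definition V24 :: "((F2 \<times> F2) \<times> F2 \<times> F3) monoid"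
  where "V24 = \<lparr>carrier = UNIV, mult = (+), one = 0\<rparr>"

lemma V24_simps [simp]: "carrier V24 = UNIV" "mult V24 = (+)" "\<one>\<^bsub>V24\<^esub> = 0"
  by (simp_all add: V24_def)

lemma comm_group_V24: "comm_group V24"
proof (rule comm_groupI)
  fix a
  show "\<exists>b\<in>carrier V24. b \<otimes>\<^bsub>V24\<^esub> a = \<one>\<^bsub>V24\<^esub>"
    by (rule bexI[of _ "- a"]) (simp_all only: V24_simps left_minus UNIV_I)
qed (simp_all add: ac_simps)

lemma inv_V24: "inv\<^bsub>V24\<^esub> a = - a"
  using comm_group_V24 by (intro group.inv_equality) (simp_all add: comm_group_def)

lemma lambda_map_24: "lambda_map V24 lam24"
proof (intro lambda_map.intro lambda_map_axioms.intro comm_group_V24)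
  fix a b c
  show "lam24 a (b \<otimes>\<^bsub>V24\<^esub> c) = lam24 a b \<otimes>\<^bsub>V24\<^esub> lam24 a c"
    by (cases a; cases b; cases c)
      (simp add: lam24_def Let_def rot_flip_add polar_add sign_add add_Pair)
  obtain x \<mu> t y \<nu> s z \<xi> r where abc: "a = (x, \<mu>, t)" "b = (y, \<nu>, s)" "c = (z, \<xi>, r)"
    by (metis prod.exhaust)
  define p q where "p = \<mu> - quad x" and "q = \<nu> - quad y"
  define y' where "y' = rot t (flip p y)"
  \<comment> \<open>The flip part is additive on circle products: the polar term in the middle
    coordinate cancels the one from \<open>quad_add\<close>.\<close>
  have "\<mu> + (\<nu> + polar x y') - quad (x + y') = p + q"
    by (simp add: p_def q_def quad_add y'_def quad_rot_flip)
  \<comment> \<open>Invariance of the polar form matches the middle coordinates of the two sides of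
    \<open>l_comp\<close>.\<close>
  moreover have "polar y' (rot t (flip p (rot s (flip q z)))) = polar y (rot s (flip q z))"
    by (simp add: y'_def polar_rot_flip)
  ultimately show "lam24 a (lam24 b c) = lam24 (a \<otimes>\<^bsub>V24\<^esub> lam24 a b) c"
    by (simp add: abc lam24_def Let_def add_Pair p_def[symmetric] q_def[symmetric] y'_def[symmetric]
        rot_flip_comp[symmetric] sign_sign polar_add ac_simps)
next
  fix a b :: "(F2 \<times> F2) \<times> F2 \<times> F3"
  obtain x \<mu> t y \<nu> s where ab: "a = (x, \<mu>, t)" "b = (y, \<nu>, s)" by (metis prod.exhaust)
  obtain z where z: "rot t (flip (\<mu> - quad x) z) = y" using rot_flip_surj by blast
  have "sign p (sign p s) = s" for p by (simp add: sign_def)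
  hence "lam24 a (z, \<nu> - polar x y, sign (\<mu> - quad x) s) = b"
    by (simp add: ab lam24_def Let_def z)
  thus "\<exists>c\<in>carrier V24. lam24 a c = b" by (rule bexI) simp
qed simp

interpretation L24: lambda_map V24 lam24
  by (rule lambda_map_24)

text \<open>Each of the three coordinate subgroups is obtained from differences
  \<open>lam24 a b - b\<close>, with \<open>a\<close> chosen to move that coordinate.\<close>

lemma nonzero_perfect_brace_24: "nonzero_perfect_brace (brace_of V24 lam24)"
proof -
  let ?B = "brace_of V24 lam24"
  let ?K = "{brace_star ?B a b | a b. a \<in> carrier ?B \<and> b \<in> carrier ?B}"
  have K: "lam24 a b - b \<in> generate V24 ?K" for a b
  proof (intro generate.incl CollectI exI conjI)
    show "lam24 a b - b = brace_star ?B a b"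
      using L24.star_brace_of[of a b] by (simp add: inv_V24)
  qed simp_all
  have "(y, 0, 0) \<in> generate V24 ?K" for y
  proof -
    have "\<exists>z. rot 1 z - z = y"
      \<comment> \<open>The witness is \<open>rot 1 y\<close>; it works because
        \<open>w^2 - w = 1\<close> in the field with four elements.\<close>
      by (rule exI[of _ "(snd y, fst y + snd y)"], cases y; cases "fst y"; cases "snd y")
        (simp_all add: rot_def F2_defs zero_prod_def)
    then obtain z where z: "rot 1 z - z = y" ..
    have "lam24 (0, 0, 1) (z, 0, 0) - (z, 0, 0) = (rot 1 z - z, 0, 0)"
      by (cases "rot 1 z") (simp add: lam24_def Let_def quad_def flip_def polar_def sign_def
          zero_prod_def F2_defs F3_defs)
    thus ?thesis using K[of "(0, 0, 1)" "(z, 0, 0)"] by (simp only: z)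
  qed
  moreover have "(0, \<nu>, 0) \<in> generate V24 ?K" for \<nu>
  proof -
    \<comment> \<open>Since \<open>quad (1, 0) = 1\<close>, the flip part is 0 and only the polar
      term remains.\<close>
    have "lam24 ((1, 0), 1, 0) ((0, \<nu>), 0, 0) - ((0, \<nu>), 0, 0) = (0, \<nu>, 0)"
      by (cases \<nu>) (simp_all add: lam24_def Let_def quad_def flip_def polar_def sign_def rot_def
          zero_prod_def F2_defs F3_defs)
    thus ?thesis using K[of "((1, 0), 1, 0)" "((0, \<nu>), 0, 0)"] by (simp only:)
  qed
  moreover have "(0, 0, s) \<in> generate V24 ?K" for s
  proof -
    \<comment> \<open>Now the flip part is 1, so \<open>s\<close> is negated, and
      \<open>- s - s = s\<close> modulo 3.\<close>
    have "lam24 (0, 1, 0) (0, 0, s) - (0, 0, s) = (0, 0, s)"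
      by (cases s) (simp_all add: lam24_def Let_def quad_def flip_def polar_def sign_def rot_def
          zero_prod_def F2_defs F3_defs)
    thus ?thesis using K[of "(0, 1, 0)" "(0, 0, s)"] by (simp only:)
  qed
  ultimately have gen: "(y, \<nu>, s) \<in> generate V24 ?K" for y \<nu> s
    using generate.eng[OF generate.eng, of "(y, 0, 0)" V24 ?K "(0, \<nu>, 0)" "(0, 0, s)"]
    by (simp only: V24_simps add_Pair add_0_left add_0_right)
  have "generate V24 ?K = UNIV"
  proof (rule UNIV_eq_I[symmetric])
    fix x show "x \<in> generate V24 ?K"
      by (cases x rule: prod_cases3) (simp only: gen)
  qed
  hence "perfect_brace ?B"
    unfolding perfect_brace_def brace_square_def add_monoid_brace_of by simp
  moreover have "(0, 0, 1) \<noteq> (0 :: (F2 \<times> F2) \<times> F2 \<times> F3)" by (simp add: zero_prod_def)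
  hence "UNIV \<noteq> {0 :: (F2 \<times> F2) \<times> F2 \<times> F3}" by (metis UNIV_I singletonD)
  ultimately show ?thesis
    unfolding nonzero_perfect_brace_def brace_of_simps V24_simps
    by (intro conjI L24.left_brace_brace_of finite)
qed

section \<open>Iterating the extension\<close>

lemma socle_series_extension_nat:
  fixes A :: "'a ring"
  assumes "nonzero_perfect_brace A"
  shows "\<exists>B :: nat ring. nonzero_perfect_brace B \<and>
    socle_series B (Suc 0) \<noteq> socle_series B 0 \<and>
    (\<forall>n. socle_series A (Suc n) \<noteq> socle_series A n \<longrightarrow>
      socle_series B (Suc (Suc n)) \<noteq> socle_series B (Suc n))"
proof -
  obtain E :: "(('a \<Rightarrow> int) \<times> 'a) ring" where E: "nonzero_perfect_brace E"
    "socle_series E (Suc 0) \<noteq> socle_series E 0"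
    "\<forall>n. socle_series A (Suc n) \<noteq> socle_series A n \<longrightarrow>
      socle_series E (Suc (Suc n)) \<noteq> socle_series E (Suc n)"
    using socle_series_extension[OF assms] unfolding One_nat_def by blast
  obtain B :: "nat ring" where "nonzero_perfect_brace B"
    "\<forall>n. socle_series E (Suc n) \<noteq> socle_series E n \<longrightarrow> socle_series B (Suc n) \<noteq> socle_series B n"
    using nonzero_perfect_brace_nat[OF E(1)] by blast
  with E(2,3) show ?thesis by blast
qed

text \<open>One extension of any nonzero perfect brace gives a strict step at 0, and each further
  extension shifts a strict step up by one. Only the base case uses the brace of order 24.\<close>

lemma nonzero_perfect_brace_socle_series:
  "\<exists>B :: nat ring. nonzero_perfect_brace B \<and> socle_series B (Suc n) \<noteq> socle_series B n"
proof (induction n)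
  case 0
  show ?case using socle_series_extension_nat[OF nonzero_perfect_brace_24] by blast
next
  case (Suc n)
  then obtain A :: "nat ring" where "nonzero_perfect_brace A"
    "socle_series A (Suc n) \<noteq> socle_series A n" by blast
  thus ?case using socle_series_extension_nat[of A] by blast
qed

theorem corollary3p3:
  fixes n :: nat
  assumes "n \<ge> 1"
  shows "\<exists>B :: nat ring. left_brace B \<and> finite (carrier B) \<and> perfect_brace B \<and>
    brace_socle (brace_quotient B (socle_series B n)) \<noteq> {\<zero>\<^bsub>brace_quotient B (socle_series B n)\<^esub>}"
proof -
  obtain B :: "nat ring" where "nonzero_perfect_brace B" "socle_series B (Suc n) \<noteq> socle_series B n"
    using nonzero_perfect_brace_socle_series by blast
  thus ?thesis
    using left_brace.socle_quotient_nontrivial[of B n] unfolding nonzero_perfect_brace_def by blast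
qed

end
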